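(* Let $k>1$ be an integer. The double star $P_2(1,2k)$ is not determined by its spectrum; that is, there exists a graph that is cospectral with $P_2(1,2k)$ but not isomorphic to it. Furthermore, if $k$ is even, then there are at least two nonisomorphic graphs cospectral to $P_2(1,2k)$.
   Context: All graphs are finite, simple and undirected. The spectrum of a graph is the multiset of eigenvalues of its adjacency matrix; two graphs are cospectral if they have the same spectrum. A graph $G$ is determined by its spectrum (DS) if every graph cospectral with $G$ is isomorphic to $G$. For integers $a,b\ge 0$, the double star $P_2(a,b)$ is the tree obtained from the stars $K_{1,a}$ and $K_{1,b}$ by adding an edge between their center vertices (so it has $a+b+2$ vertices, with $a$ leaves attached to one central vertex and $b$ leaves attached to the other).
   Formalization: For k = 2 only one graph nonisomorphic to P_2(1,4) is cospectral with it, so two mutually nonisomorphic cospectral graphs, both different from P_2(1,2k), are claimed only for even k other than 2; for k = 2 the two graphs may include P_2(1,4) itself. *)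

theory Defs
  imports
    "Graph_Theory.Graph_Theory"
    "Jordan_Normal_Form.Spectral_Radius"
begin

text \<open>
  A finite simple undirected graph is a \<open>pair_graph\<close>: finitely many vertices, no loops, and a
  symmetric set of arcs, so that the edge \<open>uv\<close> is represented by the two arcs \<open>(u, v)\<close> and
  \<open>(v, u)\<close>.
\<close>

abbreviation graph_iso :: "'a pair_pre_digraph \<Rightarrow> 'b pair_pre_digraph \<Rightarrow> bool" where
  "graph_iso G H \<equiv> digraph_iso (with_proj G) (with_proj H)"

lemma graph_iso_iff_bij_betw:
  assumes "pair_graph G" and "pair_graph H"
  shows "graph_iso G H \<longleftrightarrow>
    (\<exists>f. bij_betw f (pverts G) (pverts H) \<and>
      (\<forall>u\<in>pverts G. \<forall>v\<in>pverts G. (u, v) \<in> parcs G \<longleftrightarrow> (f u, f v) \<in> parcs H))"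
proof -
  interpret G: pair_graph G by fact
  interpret H: pair_graph H by fact
  show ?thesis
  proof
    assume "graph_iso G H"
    then obtain h where h: "pre_digraph.digraph_isomorphism (with_proj G) h"
      and H: "with_proj H = app_iso h (with_proj G)"
      unfolding digraph_iso_def by blast
    have inj: "inj_on (iso_verts h) (pverts G)"
      and arc: "\<And>a. a \<in> parcs G \<Longrightarrow>
        iso_verts h (fst a) = iso_tail h (iso_arcs h a) \<and>
        iso_verts h (snd a) = iso_head h (iso_arcs h a)"
      using h by (auto simp: G.digraph_isomorphism_def)
    have V: "pverts H = iso_verts h ` pverts G" and A: "parcs H = iso_arcs h ` parcs G"
      and t: "iso_tail h = fst" and hd: "iso_head h = snd"
      using H by (auto simp: with_proj_def app_iso_def)
    have arc': "iso_arcs h a = (iso_verts h (fst a), iso_verts h (snd a))" if "a \<in> parcs G" for a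
      using arc[OF that] t hd by (metis prod.collapse)
    have "(u, v) \<in> parcs G \<longleftrightarrow> (iso_verts h u, iso_verts h v) \<in> parcs H"
      if uv: "u \<in> pverts G" "v \<in> pverts G" for u v
    proof
      assume "(u, v) \<in> parcs G"
      then show "(iso_verts h u, iso_verts h v) \<in> parcs H"
        using arc' unfolding A by force
    next
      assume "(iso_verts h u, iso_verts h v) \<in> parcs H"
      then obtain a where a: "a \<in> parcs G"
        and eq: "iso_verts h u = iso_verts h (fst a)" "iso_verts h v = iso_verts h (snd a)"
        unfolding A using arc' by force
      have "u = fst a" "v = snd a"
        using inj_onD[OF inj] eq uv G.arc_fst_in_verts[OF a] G.arc_snd_in_verts[OF a] by auto
      then show "(u, v) \<in> parcs G" using a by simp
    qed
    then show "\<exists>f. bij_betw f (pverts G) (pverts H) \<and>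
      (\<forall>u\<in>pverts G. \<forall>v\<in>pverts G. (u, v) \<in> parcs G \<longleftrightarrow> (f u, f v) \<in> parcs H)"
      using inj V by (intro exI[of _ "iso_verts h"]) (auto simp: bij_betw_def)
  next
    assume "\<exists>f. bij_betw f (pverts G) (pverts H) \<and>
      (\<forall>u\<in>pverts G. \<forall>v\<in>pverts G. (u, v) \<in> parcs G \<longleftrightarrow> (f u, f v) \<in> parcs H)"
    then obtain f where inj: "inj_on f (pverts G)" and V: "f ` pverts G = pverts H"
      and adj: "\<And>u v. u \<in> pverts G \<Longrightarrow> v \<in> pverts G \<Longrightarrow>
        (u, v) \<in> parcs G \<longleftrightarrow> (f u, f v) \<in> parcs H"
      by (auto simp: bij_betw_def)
    define h where "h = \<lparr>iso_verts = f, iso_arcs = map_prod f f, iso_head = snd, iso_tail = fst\<rparr>"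
    have sub: "parcs G \<subseteq> pverts G \<times> pverts G"
      using G.in_arcsD1 G.in_arcsD2 by auto
    have "inj_on (map_prod f f) (parcs G)"
      using map_prod_inj_on[OF inj inj] sub by (rule inj_on_subset)
    then have "G.digraph_isomorphism h"
      using inj by (auto simp: G.digraph_isomorphism_def h_def G.wf_digraph)
    moreover have "map_prod f f ` parcs G = parcs H"
    proof
      show "map_prod f f ` parcs G \<subseteq> parcs H"
        using sub adj by force
      show "parcs H \<subseteq> map_prod f f ` parcs G"
      proof
        fix e assume e: "e \<in> parcs H"
        then have "fst e \<in> f ` pverts G" "snd e \<in> f ` pverts G"
          using H.arc_fst_in_verts H.arc_snd_in_verts V by auto
        then obtain u v where "u \<in> pverts G" "v \<in> pverts G" "e = (f u, f v)"
          by (metis imageE prod.collapse)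
        then show "e \<in> map_prod f f ` parcs G"
          using e adj by (force intro: image_eqI[of _ _ "(u, v)"])
      qed
    qed
    ultimately show "graph_iso G H"
      unfolding digraph_iso_def using V
      by (intro exI[of _ h]) (simp add: h_def with_proj_def app_iso_def)
  qed
qed

text \<open>Rows and columns are indexed by the vertices in increasing order.\<close>

definition adjacency_matrix :: "'a :: linorder pair_pre_digraph \<Rightarrow> complex mat" where
  "adjacency_matrix G =
    (let vs = sorted_list_of_set (pverts G); n = card (pverts G)
     in mat n n (\<lambda>(i, j). if (vs ! i, vs ! j) \<in> parcs G then 1 else 0))"

text \<open>
  The eigenvalues are counted with algebraic multiplicity. They are taken over the complex
  numbers, so that the multiset has as many elements as there are vertices; the matrix is
  symmetric with real entries, hence all of them are real.
\<close>

definition graph_spectrum :: "'a :: linorder pair_pre_digraph \<Rightarrow> complex multiset" where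
  "graph_spectrum G = proots (char_poly (adjacency_matrix G))"

lemma adjacency_matrix_carrier:
  "adjacency_matrix G \<in> carrier_mat (card (pverts G)) (card (pverts G))"
  by (simp add: adjacency_matrix_def Let_def)

lemma set_mset_graph_spectrum:
  "set_mset (graph_spectrum G) = {x. eigenvalue (adjacency_matrix G) x}"
proof -
  have "char_poly (adjacency_matrix G) \<noteq> 0"
    using degree_monic_char_poly[OF adjacency_matrix_carrier[of G]] by auto
  then show ?thesis
    by (simp add: graph_spectrum_def eigenvalue_root_char_poly[OF adjacency_matrix_carrier])
qed

lemma size_graph_spectrum: "size (graph_spectrum G) = card (pverts G)"
  using degree_monic_char_poly[OF adjacency_matrix_carrier[of G]]
  by (simp add: graph_spectrum_def size_proots_complex)

definition cospectral :: "'a :: linorder pair_pre_digraph \<Rightarrow> 'b :: linorder pair_pre_digraph \<Rightarrow> bool"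
  where "cospectral G H \<longleftrightarrow> graph_spectrum G = graph_spectrum H"

text \<open>
  Every finite graph is isomorphic to one whose vertices are natural numbers, so it is enough to
  let \<open>H\<close> range over the latter.
\<close>

definition determined_by_spectrum :: "'a :: linorder pair_pre_digraph \<Rightarrow> bool" where
  "determined_by_spectrum G \<longleftrightarrow>
    (\<forall>H :: nat pair_pre_digraph. pair_graph H \<and> cospectral H G \<longrightarrow> graph_iso H G)"

text \<open>
  The centers are \<open>0\<close> and \<open>1\<close>; the leaves at \<open>0\<close> are \<open>2, \<dots>, a + 1\<close> and those at \<open>1\<close> are
  \<open>a + 2, \<dots>, a + b + 1\<close>.
\<close>

definition double_star :: "nat \<Rightarrow> nat \<Rightarrow> nat pair_pre_digraph" where
  "double_star a b =
    (let E = {(0, 1)} \<union> {0} \<times> {2..<a + 2} \<union> {1} \<times> {a + 2..<a + b + 2}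
     in \<lparr>pverts = {..<a + b + 2}, parcs = E \<union> E\<inverse>\<rparr>)"

lemma pair_graph_double_star: "pair_graph (double_star a b)"
proof
  show "finite (parcs (double_star a b))"
    by (auto simp: double_star_def Let_def)
qed (auto simp: double_star_def Let_def symmetric_def sym_def)

end

theory Submission
  imports Defs
begin

text \<open>
  Replace the vertices of the path on four vertices by independent sets of sizes
  \<open>a, b, c, d\<close> and its edges by complete bipartite graphs. The adjacency matrix factors through
  the four classes as \<open>U V\<close>, and \<open>V U\<close> is a 4 by 4 quotient matrix, so by Sylvester's determinant
  identity the characteristic polynomial on \<open>n\<close> vertices, isolated ones included, is
  \<open>x\<^sup>n\<^sup>-\<^sup>4 (x\<^sup>4 - (ab + bc + cd) x\<^sup>2 + abcd)\<close>. The double star \<open>P\<^sub>2(1, 2k)\<close> is the blow-up with sizes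
  \<open>1, 1, 1, 2k\<close>. The sizes \<open>1, k, 1, 2\<close> and, for even \<open>k\<close>, also \<open>1, 2, k/2, 2\<close> give the same
  values \<open>2k + 2\<close> and \<open>2k\<close>. The three graphs are told apart by the number of isolated vertices
  needed to reach \<open>2k + 3\<close> vertices, namely \<open>0\<close>, \<open>k - 1\<close> and \<open>3k/2 - 2\<close>.
\<close>

section \<open>Sylvester's determinant identity\<close>

text \<open>The block matrix \<open>M\<close> is cleared to block lower triangular form in two ways,
  from the left by \<open>L\<close> and from the right by \<open>R\<close>. Comparing
  \<open>det M\<close> in both products gives the identity. No division occurs, so \<open>x\<close>
  may be the polynomial variable.\<close>

lemma det_smult_one_minus_mult_commute:
  fixes U V :: "'a :: idom mat"
  assumes U: "U \<in> carrier_mat n m" and V: "V \<in> carrier_mat m n"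
  shows "x ^ m * det (x \<cdot>\<^sub>m 1\<^sub>m n - U * V) = x ^ n * det (x \<cdot>\<^sub>m 1\<^sub>m m - V * U)"
proof -
  define M where "M = four_block_mat (x \<cdot>\<^sub>m 1\<^sub>m n) U V (1\<^sub>m m)"
  define L where "L = four_block_mat (1\<^sub>m n) (- U) (0\<^sub>m m n) (1\<^sub>m m)"
  define R where "R = four_block_mat (1\<^sub>m n) (- U) (0\<^sub>m m n) (x \<cdot>\<^sub>m 1\<^sub>m m)"
  have M: "M \<in> carrier_mat (n + m) (n + m)" and L: "L \<in> carrier_mat (n + m) (n + m)"
    and R: "R \<in> carrier_mat (n + m) (n + m)"
    using U V by (auto simp: M_def L_def R_def)
  have xUV: "x \<cdot>\<^sub>m 1\<^sub>m n - U * V \<in> carrier_mat n n"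
    and xVU: "x \<cdot>\<^sub>m 1\<^sub>m m - V * U \<in> carrier_mat m m"
    using U V by auto
  have xU: "x \<cdot>\<^sub>m 1\<^sub>m n * - U + U * (x \<cdot>\<^sub>m 1\<^sub>m m) = 0\<^sub>m n m"
    using U by (intro eq_matI) (auto simp: mult_smult_distrib[OF U])
  have "L * M = four_block_mat (x \<cdot>\<^sub>m 1\<^sub>m n - U * V) (0\<^sub>m n m) V (1\<^sub>m m)"
    unfolding L_def M_def using U V
    by (subst mult_four_block_mat[where ?n1.0 = n and ?n2.0 = m])
       (auto intro!: arg_cong4[where f = four_block_mat] eq_matI)
  then have 1: "det L * det M = det (x \<cdot>\<^sub>m 1\<^sub>m n - U * V)"
    by (simp add: det_mult[OF L M, symmetric] det_four_block_mat_upper_right_zero[OF xUV refl V])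
  have "M * R = four_block_mat (x \<cdot>\<^sub>m 1\<^sub>m n) (0\<^sub>m n m) V (x \<cdot>\<^sub>m 1\<^sub>m m - V * U)"
    unfolding R_def M_def using U V xU
    by (subst mult_four_block_mat[where ?n1.0 = n and ?n2.0 = m])
       (auto intro!: arg_cong4[where f = four_block_mat] eq_matI)
  then have 2: "det M * det R = x ^ n * det (x \<cdot>\<^sub>m 1\<^sub>m m - V * U)"
    by (simp add: det_mult[OF M R, symmetric] det_four_block_mat_upper_right_zero[OF _ refl V xVU])
  have "det L = 1" "det R = x ^ m"
    using U by (simp_all add: L_def R_def det_four_block_mat_lower_left_zero[where n = n and m = m])
  with 1 2 show ?thesis by (simp add: mult.commute)
qed

section \<open>Characteristic polynomials of blow-ups\<close>

definition class_graph :: "nat \<Rightarrow> (nat \<Rightarrow> 'c) \<Rightarrow> ('c \<Rightarrow> 'c \<Rightarrow> bool) \<Rightarrow> nat pair_pre_digraph" where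
  "class_graph n c R =
    \<lparr>pverts = {..<n}, parcs = {(u, v). u < n \<and> v < n \<and> R (c u) (c v)}\<rparr>"

lemma pair_graph_class_graph:
  assumes "\<And>p q. R p q \<Longrightarrow> R q p" and "\<And>p. \<not> R p p"
  shows "pair_graph (class_graph n c R)"
proof
  have "parcs (class_graph n c R) \<subseteq> {..<n} \<times> {..<n}"
    by (auto simp: class_graph_def)
  then show "finite (parcs (class_graph n c R))"
    by (rule finite_subset) auto
qed (use assms in \<open>auto simp: class_graph_def symmetric_def sym_def\<close>)

lemma adjacency_matrix_class_graph:
  "adjacency_matrix (class_graph n c R) = mat n n (\<lambda>(i, j). if R (c i) (c j) then 1 else 0)"
  by (intro eq_matI)
     (auto simp: adjacency_matrix_def class_graph_def lessThan_atLeast0 Let_def)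

definition class_size :: "nat \<Rightarrow> (nat \<Rightarrow> 'c) \<Rightarrow> 'c \<Rightarrow> nat" where
  "class_size n c p = card {v. v < n \<and> c v = p}"

text \<open>Here \<open>U\<close> records the class of each vertex and \<open>V\<close> the
  adjacency of classes to vertices, so \<open>U * V\<close> is the adjacency matrix and
  \<open>V * U\<close> the quotient matrix weighted by class sizes.\<close>

lemma char_poly_class_graph:
  assumes R: "\<And>p q. R p q \<Longrightarrow> p < m"
  shows "[:0, 1:] ^ m * char_poly (adjacency_matrix (class_graph n c R)) =
    [:0, 1:] ^ n * det (mat m m (\<lambda>(p, q).
      (if p = q then [:0, 1:] else 0) - (if R p q then of_nat (class_size n c q) else 0)))"
proof -
  define U :: "complex poly mat" where "U = mat n m (\<lambda>(v, p). if c v = p then 1 else 0)"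
  define V :: "complex poly mat" where "V = mat m n (\<lambda>(p, v). if R p (c v) then 1 else 0)"
  have U: "U \<in> carrier_mat n m" and V: "V \<in> carrier_mat m n"
    by (auto simp: U_def V_def)
  have "(U * V) $$ (i, j) = (if R (c i) (c j) then 1 else 0)" if "i < n" "j < n" for i j
  proof -
    have "(U * V) $$ (i, j) = (\<Sum>p = 0..<m. (if c i = p then 1 else 0) * (if R p (c j) then 1 else 0))"
      using that by (simp add: U_def V_def scalar_prod_def)
    also have "\<dots> = (\<Sum>p = 0..<m. if c i = p then (if R p (c j) then 1 else 0) else 0)"
      by (rule sum.cong) auto
    \<comment> \<open>Only \<open>p = c i\<close> contributes. If \<open>c i\<close> is at least
      \<open>m\<close>, the sum is 0, and by \<open>R\<close> so is the adjacency entry.\<close>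
    finally show ?thesis
      using R by auto
  qed
  then have "char_poly_matrix (adjacency_matrix (class_graph n c R)) = [:0, 1:] \<cdot>\<^sub>m 1\<^sub>m n - U * V"
    using U V by (intro eq_matI)
      (auto simp: char_poly_matrix_def adjacency_matrix_class_graph one_pCons)
  moreover have "(V * U) $$ (p, q) = (if R p q then of_nat (class_size n c q) else 0)"
    if "p < m" "q < m" for p q
  proof -
    have "(V * U) $$ (p, q) = (\<Sum>v = 0..<n. (if R p (c v) then 1 else 0) * (if c v = q then 1 else 0))"
      using that by (simp add: U_def V_def scalar_prod_def)
    also have "\<dots> = (\<Sum>v\<in>{v. v < n \<and> c v = q}. if R p q then 1 else 0)"
      by (rule sum.mono_neutral_cong_right) auto
    finally show ?thesis by (simp add: class_size_def)
  qed
  then have "[:0, 1:] \<cdot>\<^sub>m 1\<^sub>m m - V * U = mat m m (\<lambda>(p, q).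
      (if p = q then [:0, 1:] else 0) - (if R p q then of_nat (class_size n c q) else 0))"
    using U V by (intro eq_matI) auto
  ultimately show ?thesis
    using det_smult_one_minus_mult_commute[OF U V, of "[:0, 1:]"] by (simp add: char_poly_def)
qed

text \<open>Labels from \<open>4\<close> on are adjacent to nothing: they mark isolated vertices.\<close>

definition path_adj :: "nat \<Rightarrow> nat \<Rightarrow> bool" where
  "path_adj p q \<longleftrightarrow> p < 4 \<and> q < 4 \<and> (q = Suc p \<or> p = Suc q)"

abbreviation path_blowup :: "nat \<Rightarrow> (nat \<Rightarrow> nat) \<Rightarrow> nat pair_pre_digraph" where
  "path_blowup n c \<equiv> class_graph n c path_adj"

lemma pair_graph_path_blowup: "pair_graph (path_blowup n c)"
  by (rule pair_graph_class_graph) (auto simp: path_adj_def)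

text \<open>Laplace expansion along the first row, with the minors again in the form
  \<open>mat n n\<close>, so that rewriting can repeat it until an explicit determinant is
  evaluated.\<close>

lemma det_mat_Suc:
  fixes f :: "nat \<times> nat \<Rightarrow> 'a :: comm_ring_1"
  shows "det (mat (Suc n) (Suc n) f) =
    (\<Sum>j<Suc n. f (0, j) * (- 1) ^ j *
      det (mat n n (\<lambda>(i, k). f (Suc i, if k < j then k else Suc k))))"
proof -
  have "mat_delete (mat (Suc n) (Suc n) f) 0 j =
    mat n n (\<lambda>(i, k). f (Suc i, if k < j then k else Suc k))" for j
    by (intro eq_matI) (auto simp: mat_delete_def)
  then show ?thesis
    by (subst laplace_expansion_row[of _ "Suc n" 0]) (auto simp: cofactor_def intro!: sum.cong)
qed

lemma det_path_blowup:
  fixes x :: "'a :: comm_ring_1" and s :: "nat \<Rightarrow> 'a"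
  shows "det (mat 4 4 (\<lambda>(p, q). (if p = q then x else 0) - (if path_adj p q then s q else 0))) =
    x ^ 4 - (s 0 * s 1 + s 1 * s 2 + s 2 * s 3) * x ^ 2 + s 0 * s 1 * s 2 * s 3"
  by (simp add: numeral_eq_Suc det_mat_Suc path_adj_def) (simp add: algebra_simps)

text \<open>For fixed \<open>n\<close> the characteristic polynomial depends on the class sizes only
  through these two expressions; the common factor of degree 4 cancels.\<close>

lemma cospectral_path_blowup:
  assumes "class_size n c 0 * class_size n c 1 + class_size n c 1 * class_size n c 2
      + class_size n c 2 * class_size n c 3 =
      class_size n d 0 * class_size n d 1 + class_size n d 1 * class_size n d 2
      + class_size n d 2 * class_size n d 3"
    and "class_size n c 0 * class_size n c 1 * class_size n c 2 * class_size n c 3 =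
      class_size n d 0 * class_size n d 1 * class_size n d 2 * class_size n d 3"
  shows "cospectral (path_blowup n c) (path_blowup n d)"
proof -
  have "[:0, 1:] ^ 4 * char_poly (adjacency_matrix (path_blowup n e)) =
    [:0, 1:] ^ n * ([:0, 1:] ^ 4
      - of_nat (class_size n e 0 * class_size n e 1 + class_size n e 1 * class_size n e 2
          + class_size n e 2 * class_size n e 3) * [:0, 1:] ^ 2
      + of_nat (class_size n e 0 * class_size n e 1 * class_size n e 2 * class_size n e 3))" for e
    by (subst char_poly_class_graph) (auto simp: path_adj_def det_path_blowup[unfolded path_adj_def])
  then have "[:0, 1:] ^ 4 * char_poly (adjacency_matrix (path_blowup n c)) =
      [:0, 1:] ^ 4 * char_poly (adjacency_matrix (path_blowup n d))"
    by (simp only: assms)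
  then show ?thesis
    by (simp add: cospectral_def graph_spectrum_def)
qed

section \<open>Isolated vertices as an isomorphism invariant\<close>

definition isolated :: "'a pair_pre_digraph \<Rightarrow> 'a set" where
  "isolated G = {u \<in> pverts G. \<forall>v\<in>pverts G. (u, v) \<notin> parcs G}"

lemma graph_iso_card_isolated:
  assumes "pair_graph G" and "pair_graph H" and "graph_iso G H"
  shows "card (isolated G) = card (isolated H)"
proof -
  obtain f where f: "bij_betw f (pverts G) (pverts H)"
    and adj: "\<And>u v. u \<in> pverts G \<Longrightarrow> v \<in> pverts G \<Longrightarrow>
      (u, v) \<in> parcs G \<longleftrightarrow> (f u, f v) \<in> parcs H"
    using assms(3) unfolding graph_iso_iff_bij_betw[OF assms(1,2)] by blast
  have V: "pverts H = f ` pverts G"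
    using f by (simp add: bij_betw_def)
  have "f u \<in> isolated H \<longleftrightarrow> u \<in> isolated G" if "u \<in> pverts G" for u
    using that adj by (simp add: isolated_def V)
  moreover have "isolated G \<subseteq> pverts G" "isolated H \<subseteq> f ` pverts G"
    by (auto simp: isolated_def V)
  ultimately have "f ` isolated G = isolated H"
    by blast
  moreover have "inj_on f (isolated G)"
    using f by (auto simp: bij_betw_def isolated_def intro: inj_on_subset)
  ultimately show ?thesis
    by (metis card_image)
qed

text \<open>The classes are consecutive intervals of vertices; all later vertices get the label 4,
  which \<open>path_adj\<close> relates to nothing.\<close>

definition segment_class :: "nat \<Rightarrow> nat \<Rightarrow> nat \<Rightarrow> nat \<Rightarrow> nat \<Rightarrow> nat" where
  "segment_class a b c d v =
    (if v < a then 0 else if v < a + b then 1 else if v < a + b + c then 2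
     else if v < a + b + c + d then 3 else 4)"

lemma class_size_segment_class:
  assumes "a + b + c + d \<le> n"
  shows "class_size n (segment_class a b c d) 0 = a" "class_size n (segment_class a b c d) 1 = b"
    "class_size n (segment_class a b c d) 2 = c" "class_size n (segment_class a b c d) 3 = d"
proof -
  have "{v. v < n \<and> segment_class a b c d v = 0} = {..<a}"
    "{v. v < n \<and> segment_class a b c d v = 1} = {a..<a + b}"
    "{v. v < n \<and> segment_class a b c d v = 2} = {a + b..<a + b + c}"
    "{v. v < n \<and> segment_class a b c d v = 3} = {a + b + c..<a + b + c + d}"
    using assms by (auto simp: segment_class_def split: if_splits)
  then show "class_size n (segment_class a b c d) 0 = a" "class_size n (segment_class a b c d) 1 = b"
    "class_size n (segment_class a b c d) 2 = c" "class_size n (segment_class a b c d) 3 = d"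
    by (simp_all add: class_size_def)
qed

text \<open>Every class of the path has a neighbouring class, which is nonempty by positivity, so
  exactly the vertices labelled 4 are isolated.\<close>

lemma card_isolated_segment_class:
  assumes "a + b + c + d \<le> n" and "0 < a" "0 < b" "0 < c" "0 < d"
  shows "card (isolated (path_blowup n (segment_class a b c d))) = n - (a + b + c + d)"
proof -
  have "u \<in> isolated (path_blowup n (segment_class a b c d)) \<longleftrightarrow> u \<in> {a + b + c + d..<n}" for u
  proof -
    have "\<exists>v<n. path_adj (segment_class a b c d u) (segment_class a b c d v)"
      if "u < a + b + c + d"
    proof -
      \<comment> \<open>In each case the witness is the first vertex of a neighbouring class:
        \<open>0\<close>, \<open>a\<close> and \<open>a + b\<close> start the classes 0, 1 and
        2.\<close>
      consider "u < a" | "a \<le> u" "u < a + b" | "a + b \<le> u" "u < a + b + c" | "a + b + c \<le> u"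
        by linarith
      then show ?thesis
      proof cases
        case 1
        then show ?thesis using assms by (intro exI[of _ a]) (auto simp: segment_class_def path_adj_def)
      next
        case 2
        then show ?thesis using assms by (intro exI[of _ 0]) (auto simp: segment_class_def path_adj_def)
      next
        case 3
        then show ?thesis using assms by (intro exI[of _ a]) (auto simp: segment_class_def path_adj_def)
      next
        case 4
        then show ?thesis using assms that
          by (intro exI[of _ "a + b"]) (auto simp: segment_class_def path_adj_def)
      qed
    qed
    moreover have "\<not> path_adj (segment_class a b c d u) q" if "a + b + c + d \<le> u" for q
      using that by (auto simp: segment_class_def path_adj_def)
    moreover have "u \<in> isolated (path_blowup n (segment_class a b c d)) \<longleftrightarrow>
      u < n \<and> (\<forall>v<n. \<not> path_adj (segment_class a b c d u) (segment_class a b c d v))"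
      by (auto simp: isolated_def class_graph_def)
    ultimately show ?thesis
      by (metis atLeastLessThan_iff not_le)
  qed
  then show ?thesis
    by (metis card_atLeastLessThan subsetI subset_antisym)
qed

section \<open>The double star and its cospectral mates\<close>

text \<open>The path of classes runs from the single leaf 2 through the centers 0 and 1 to the
  remaining leaves. With labels matched to this numbering, the graphs are equal and not merely
  isomorphic.\<close>

lemma double_star_eq_path_blowup:
  "double_star 1 b =
    path_blowup (b + 3) (\<lambda>v. if v = 0 then 1 else if v = 1 then 2 else if v = 2 then 0 else 3)"
  by (auto simp: double_star_def class_graph_def path_adj_def Let_def split: if_splits)

lemma isolated_double_star: "isolated (double_star a b) = {}"
proof -
  have "\<exists>v\<in>pverts (double_star a b). (u, v) \<in> parcs (double_star a b)"
    if "u \<in> pverts (double_star a b)" for u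
    \<comment> \<open>The centers are neighbours of each other, and each leaf is adjacent to its
      center.\<close>
    using that by (intro bexI[of _ "if u = 0 then 1 else if u < a + 2 then 0 else 1"])
      (auto simp: double_star_def Let_def)
  then show ?thesis
    by (auto simp: isolated_def)
qed

text \<open>The class sizes 1, 1, 1, \<open>m\<close> of the double star give the values
  \<open>m + 2\<close> and \<open>m\<close>; the inequality leaves room for all four classes among
  its \<open>m + 3\<close> vertices.\<close>

lemma cospectral_double_star_1:
  assumes "a + b + c + d \<le> m + 3"
    and "a * b + b * c + c * d = m + 2" and "a * b * c * d = m"
  shows "cospectral (path_blowup (m + 3) (segment_class a b c d)) (double_star 1 m)"
proof -
  let ?e = "\<lambda>v :: nat. if v = 0 then 1 else if v = 1 then 2 else if v = 2 then 0 else 3 :: nat"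
  have "{v. v < m + 3 \<and> ?e v = 0} = {2}" "{v. v < m + 3 \<and> ?e v = 1} = {0}"
    "{v. v < m + 3 \<and> ?e v = 2} = {1}" "{v. v < m + 3 \<and> ?e v = 3} = {3..<m + 3}"
    by auto
  then have "class_size (m + 3) ?e 0 = 1" "class_size (m + 3) ?e 1 = 1"
    "class_size (m + 3) ?e 2 = 1" "class_size (m + 3) ?e 3 = m"
    by (simp_all add: class_size_def)
  then show ?thesis
    unfolding double_star_eq_path_blowup
    by (intro cospectral_path_blowup)
      (simp_all only: class_size_segment_class[OF assms(1)] assms(2,3) mult_1)
qed

theorem theorem2p4:
  fixes k :: nat
  assumes "k > 1"
  shows "\<not> determined_by_spectrum (double_star 1 (2 * k)) \<and>
    (even k \<longrightarrow>
      (\<exists>(H\<^sub>1 :: nat pair_pre_digraph) (H\<^sub>2 :: nat pair_pre_digraph).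
        pair_graph H\<^sub>1 \<and> pair_graph H\<^sub>2 \<and>
        cospectral H\<^sub>1 (double_star 1 (2 * k)) \<and> cospectral H\<^sub>2 (double_star 1 (2 * k)) \<and>
        \<not> graph_iso H\<^sub>1 H\<^sub>2)) \<and>
    (even k \<and> k \<noteq> 2 \<longrightarrow>
      (\<exists>(H\<^sub>1 :: nat pair_pre_digraph) (H\<^sub>2 :: nat pair_pre_digraph).
        pair_graph H\<^sub>1 \<and> pair_graph H\<^sub>2 \<and>
        cospectral H\<^sub>1 (double_star 1 (2 * k)) \<and> cospectral H\<^sub>2 (double_star 1 (2 * k)) \<and>
        \<not> graph_iso H\<^sub>1 (double_star 1 (2 * k)) \<and> \<not> graph_iso H\<^sub>2 (double_star 1 (2 * k)) \<and>
        \<not> graph_iso H\<^sub>1 H\<^sub>2))"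
proof -
  let ?S = "double_star 1 (2 * k)"
  define H where "H = path_blowup (2 * k + 3) (segment_class 1 k 1 2)"
  have H: "pair_graph H" "cospectral H ?S" "card (isolated H) = k - 1"
    unfolding H_def using assms
    by (simp_all add: pair_graph_path_blowup cospectral_double_star_1[unfolded One_nat_def]
      card_isolated_segment_class)
  have "card (isolated ?S) = 0"
    by (simp add: isolated_double_star)
  then have H_S: "\<not> graph_iso H ?S"
    using graph_iso_card_isolated[OF H(1) pair_graph_double_star] H(3) assms by fastforce
  \<comment> \<open>For \<open>k = 2\<close> the sizes \<open>1, 2, k/2, 2\<close> would be those of
    \<open>H\<close>, so a second mate arises this way only for larger even
    \<open>k\<close>.\<close>
  have "\<exists>H' :: nat pair_pre_digraph. pair_graph H' \<and> cospectral H' ?S \<and>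
    \<not> graph_iso H' ?S \<and> \<not> graph_iso H H'" if k: "even k" "k \<noteq> 2"
  proof -
    obtain j where "k = 2 * j"
      using k(1) by (rule evenE)
    then have j: "k = 2 * j" "j > 1"
      using k(2) assms by auto
    define H' where "H' = path_blowup (2 * k + 3) (segment_class 1 2 j 2)"
    have H': "pair_graph H'" "cospectral H' ?S" "card (isolated H') = 3 * j - 2"
      unfolding H'_def using j
      by (simp_all add: pair_graph_path_blowup cospectral_double_star_1[unfolded One_nat_def]
        card_isolated_segment_class)
    have "\<not> graph_iso H' ?S"
      using graph_iso_card_isolated[OF H'(1) pair_graph_double_star] H'(3) j
        \<open>card (isolated ?S) = 0\<close> by fastforce
    \<comment> \<open>The counts \<open>2 * j - 1\<close> and \<open>3 * j - 2\<close> agree only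
      for \<open>j = 1\<close>.\<close>
    moreover have "\<not> graph_iso H H'"
      using graph_iso_card_isolated[OF H(1) H'(1)] H(3) H'(3) j by auto
    ultimately show ?thesis
      using H' by blast
  qed
  \<comment> \<open>The pair for every even \<open>k\<close>, including 2, is \<open>H\<close>
    together with the double star itself.\<close>
  moreover have "cospectral ?S ?S"
    by (simp add: cospectral_def)
  ultimately show ?thesis
    using H H_S pair_graph_double_star unfolding determined_by_spectrum_def by blast
qed

end
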